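(* Let $p>0$ be a real number and define, for $x\in\bigl(0,\frac{\pi}{2}\bigr]$, $$f_p(x)=\frac{\sin x}{x(1+p\cos x)}.$$ Then: (1) if $p\ge\frac{2}{\pi}$, the function $f_p$ is strictly increasing on $\bigl(0,\frac{\pi}{2}\bigr]$; (2) if $p\le\frac12$, the function $f_p$ is strictly decreasing on $\bigl(0,\frac{\pi}{2}\bigr]$; (3) if $\frac12<p<\frac{2}{\pi}$, the function $f_p$ has a unique maximum on $\bigl(0,\frac{\pi}{2}\bigr]$.
   Context: In (3), "has a unique maximum" means that $f_p$ attains its maximum over $\bigl(0,\frac{\pi}{2}\bigr]$ at exactly one point of this interval. *)

theory Defs
  imports Complex_Main
begin

definition f :: "real \<Rightarrow> real \<Rightarrow> real" where
  "f p x = sin x / (x * (1 + p * cos x))"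

end

theory Submission
  imports Defs
begin

text \<open>
  Write \<open>u x = sin x - x * cos x\<close> and \<open>v x = x - sin x * cos x\<close>.  The quotient rule gives
  \<open>f p\<close> a derivative with numerator \<open>p * v x - u x = v x * (p - u x / v x)\<close>, and \<open>v\<close> is positive,
  so the sign of the derivative is that of \<open>p - h x\<close> where \<open>h = u / v\<close>, called
  \<open>threshold\<close> below, does not depend on \<open>p\<close>.
  Everything follows once \<open>h\<close> is known to be strictly increasing with infimum \<open>1 / 2\<close> (approached
  at \<open>0\<close>) and maximum \<open>h (pi / 2) = 2 / pi\<close>: \<open>p\<close> is then at least the maximum,
  at most the infimum, or strictly between them, and in the last case the derivative changes sign exactly once,
  from positive to negative.

  To see that \<open>h\<close> is increasing, use the monotone form of l'Hopital's rule
  (\<open>strict_mono_on_difference_quotient\<close>): as \<open>u\<close> and \<open>v\<close> vanish at \<open>0\<close>, it suffices that the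
  quotient of derivatives \<open>u' x / v' x = x / (2 * sin x)\<close> is increasing.  That is again a quotient
  of functions vanishing at \<open>0\<close>, and the quotient of their derivatives is \<open>1 / (2 * cos x)\<close>, which
  is visibly increasing and exceeds \<open>1 / 2\<close>.  The mean value theorem behind the rule
  also transfers bounds, so the chain gives \<open>1 / 2 < h x < x / (2 * sin x) < 1 / (2 * cos x)\<close>
  on the open interval.
\<close>

section \<open>Quotients of increments\<close>

text \<open>
  Cauchy's mean value theorem, phrased with a function \<open>r\<close> that plays the part of \<open>u' / v'\<close>.
  The conditions on derivatives concern the open interval only: below, \<open>u' / v'\<close> is
  \<open>1 / (2 * cos t)\<close>, singular at \<open>pi / 2\<close>, or \<open>t / (2 * sin t)\<close>, whose formal value at \<open>0\<close> is
  not its limit \<open>1 / 2\<close>.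
\<close>

lemma increment_eq_ratio_times_increment:
  fixes u v r v' :: "real \<Rightarrow> real"
  assumes xy: "x < y"
    and contu: "continuous_on {x..y} u" and contv: "continuous_on {x..y} v"
    and du: "\<And>t. x < t \<Longrightarrow> t < y \<Longrightarrow> (u has_real_derivative r t * v' t) (at t)"
    and dv: "\<And>t. x < t \<Longrightarrow> t < y \<Longrightarrow> (v has_real_derivative v' t) (at t)"
    and pos: "\<And>t. x < t \<Longrightarrow> t < y \<Longrightarrow> 0 < v' t"
  shows "v x < v y" and "\<exists>t. x < t \<and> t < y \<and> u y - u x = r t * (v y - v x)"
proof -
  show "v x < v y"
    using dv pos by (intro DERIV_pos_imp_increasing_open[OF xy _ contv]) blast
  \<comment> \<open>This combination takes the same value at \<open>x\<close> and \<open>y\<close>.\<close>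
  define w where "w = (\<lambda>t. (u y - u x) * v t - (v y - v x) * u t)"
  have dw: "(w has_real_derivative (u y - u x) * v' t - (v y - v x) * (r t * v' t)) (at t)"
    if "x < t" "t < y" for t
    unfolding w_def by (intro derivative_intros du dv that DERIV_cmult)
  have "continuous_on {x..y} w"
    unfolding w_def by (intro continuous_intros contu contv)
  then obtain l t where t: "x < t" "t < y"
    and l: "(w has_real_derivative l) (at t)" "w y - w x = (y - x) * l"
    using MVT[OF xy, of w] dw by (metis real_differentiable_def)
  have "w y = w x" by (simp add: w_def algebra_simps)
  then have "l = 0" using l(2) xy by simp
  then have "(u y - u x) * v' t = (v y - v x) * (r t * v' t)"
    using DERIV_unique[OF l(1) dw[OF t]] by simp
  then have "u y - u x = r t * (v y - v x)"
    using pos[OF t] by (simp add: mult_ac)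
  then show "\<exists>t. x < t \<and> t < y \<and> u y - u x = r t * (v y - v x)"
    using t by blast
qed

text \<open>
  The monotone form of l'Hopital's rule.  The quotient at \<open>x\<close> is a value of \<open>r\<close> to the left of
  \<open>x\<close>, while the increments between \<open>x\<close> and \<open>y\<close> have as quotient a value of \<open>r\<close> to the right of \<open>x\<close>,
  which is larger; the quotient at \<open>y\<close> is a weighted mean of the two.
\<close>

lemma strict_mono_on_difference_quotient:
  fixes u v r v' :: "real \<Rightarrow> real"
  assumes contu: "continuous_on {a..b} u" and contv: "continuous_on {a..b} v"
    and du: "\<And>t. a < t \<Longrightarrow> t < b \<Longrightarrow> (u has_real_derivative r t * v' t) (at t)"
    and dv: "\<And>t. a < t \<Longrightarrow> t < b \<Longrightarrow> (v has_real_derivative v' t) (at t)"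
    and pos: "\<And>t. a < t \<Longrightarrow> t < b \<Longrightarrow> 0 < v' t"
    and r: "strict_mono_on {a<..<b} r"
  shows "strict_mono_on {a<..b} (\<lambda>x. (u x - u a) / (v x - v a))"
proof (rule strict_mono_onI)
  fix x y assume "x \<in> {a<..b}" "y \<in> {a<..b}" and xy: "x < y"
  then have ax: "a < x" and yb: "y \<le> b" by auto
  have sub: "{a..x} \<subseteq> {a..b}" "{x..y} \<subseteq> {a..b}" using ax xy yb by auto
  note cont_left = continuous_on_subset[OF contu sub(1)] continuous_on_subset[OF contv sub(1)]
  note cont_right = continuous_on_subset[OF contu sub(2)] continuous_on_subset[OF contv sub(2)]
  note left = increment_eq_ratio_times_increment[OF ax cont_left du dv pos]
  note right = increment_eq_ratio_times_increment[OF xy cont_right du dv pos]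
  have vx: "v a < v x"
    by (rule left(1)) (use xy yb in auto)
  have vy: "v x < v y"
    by (rule right(1)) (use ax yb in auto)
  have "\<exists>s. a < s \<and> s < x \<and> u x - u a = r s * (v x - v a)"
    by (rule left(2)) (use xy yb in auto)
  then obtain s where s: "a < s" "s < x" "u x - u a = r s * (v x - v a)" by blast
  have "\<exists>t. x < t \<and> t < y \<and> u y - u x = r t * (v y - v x)"
    by (rule right(2)) (use ax yb in auto)
  then obtain t where t: "x < t" "t < y" "u y - u x = r t * (v y - v x)" by blast
  have "r s < r t"
    using s t ax xy yb by (intro strict_mono_onD[OF r]) auto
  then have "r s * (v y - v x) < r t * (v y - v x)"
    using vy by simp
  then have "r s * (v y - v a) < u y - u a"
    using s(3) t(3) by (simp add: algebra_simps)
  then have "r s < (u y - u a) / (v y - v a)"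
    using vx vy by (simp add: pos_less_divide_eq)
  moreover have "(u x - u a) / (v x - v a) = r s"
    using s(3) vx by (simp add: field_simps)
  ultimately show "(u x - u a) / (v x - v a) < (u y - u a) / (v y - v a)" by simp
qed

section \<open>The threshold function\<close>

lemma half_quotient_id_sin_eq:
  fixes x :: real
  assumes "0 < x" "x \<le> pi / 2"
  shows "\<exists>t. 0 < t \<and> t < x \<and> x / (2 * sin x) = 1 / (2 * cos t)"
proof -
  have cos: "0 < cos t" if "0 < t" "t < x" for t
    using that assms by (intro cos_gt_zero_pi) auto
  have "((\<lambda>x. x) has_real_derivative 1 / (2 * cos t) * (2 * cos t)) (at t)"
    if "0 < t" "t < x" for t
    using cos[OF that] by simp
  then have "\<exists>t. 0 < t \<and> t < x \<and> x - 0 = 1 / (2 * cos t) * (2 * sin x - 2 * sin 0)"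
    using assms cos
    by (intro increment_eq_ratio_times_increment(2)[where v' = "\<lambda>t. 2 * cos t"])
       (auto intro!: continuous_intros derivative_eq_intros)
  then obtain t where t: "0 < t" "t < x" "x = 1 / (2 * cos t) * (2 * sin x)" by auto
  moreover have "0 < sin x" using assms by (intro sin_gt_zero) auto
  ultimately have "x / (2 * sin x) = 1 / (2 * cos t)"
    by (subst nonzero_divide_eq_eq) simp_all
  then show ?thesis using t by blast
qed

lemma strict_mono_on_half_quotient_id_sin:
  "strict_mono_on {0<..pi / 2} (\<lambda>x :: real. x / (2 * sin x))"
proof -
  have cos: "0 < cos t" if "0 < t" "t < pi / 2" for t :: real
    using that by (intro cos_gt_zero_pi) auto
  have "strict_mono_on {0<..<pi / 2} (\<lambda>t :: real. 1 / (2 * cos t))"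
    using cos by (intro strict_mono_onI divide_strict_left_mono mult_strict_left_mono
        cos_monotone_0_pi) auto
  moreover have "((\<lambda>x. x) has_real_derivative 1 / (2 * cos t) * (2 * cos t)) (at t)"
    if "0 < t" "t < pi / 2" for t
    using cos[OF that] by simp
  ultimately have "strict_mono_on {0<..pi / 2} (\<lambda>x :: real. (x - 0) / (2 * sin x - 2 * sin 0))"
    using cos
    by (intro strict_mono_on_difference_quotient[where v' = "\<lambda>t. 2 * cos t"])
       (auto intro!: continuous_intros derivative_eq_intros)
  then show ?thesis by simp
qed

text \<open>
  The value of \<open>p\<close> at which the derivative of \<open>f p\<close> vanishes at \<open>x\<close>.
\<close>

definition threshold :: "real \<Rightarrow> real" where
  "threshold x = (sin x - x * cos x) / (x - sin x * cos x)"

lemma threshold_denominator_pos: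
  fixes x :: real
  assumes "0 < x" "x \<le> pi / 2"
  shows "0 < x - sin x * cos x"
proof -
  have "0 \<le> cos x" using assms by (intro cos_ge_zero) auto
  moreover have "cos x < cos 0" using assms by (intro cos_monotone_0_pi) auto
  ultimately have "sin x * cos x \<le> x * cos x" "x * cos x < x * 1"
    using assms sin_x_le_x[of x] by (auto intro!: mult_right_mono)
  then show ?thesis by simp
qed

lemma threshold_derivatives:
  fixes t :: real
  assumes "0 < t" "t < pi / 2"
  shows "((\<lambda>x. sin x - x * cos x) has_real_derivative t / (2 * sin t) * (2 * (sin t)\<^sup>2)) (at t)"
    and "((\<lambda>x. x - sin x * cos x) has_real_derivative 2 * (sin t)\<^sup>2) (at t)"
    and "0 < 2 * (sin t)\<^sup>2"
proof -
  have sin: "0 < sin t" using assms by (intro sin_gt_zero) auto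
  then show "0 < 2 * (sin t)\<^sup>2" by simp
  show "((\<lambda>x. sin x - x * cos x) has_real_derivative t / (2 * sin t) * (2 * (sin t)\<^sup>2)) (at t)"
    using sin by (auto intro!: derivative_eq_intros simp: power2_eq_square)
  have "1 - (cos t * cos t - sin t * sin t) = 2 * (sin t)\<^sup>2"
    using sin_cos_squared_add[of t] by (simp add: power2_eq_square)
  then show "((\<lambda>x. x - sin x * cos x) has_real_derivative 2 * (sin t)\<^sup>2) (at t)"
    by (auto intro!: derivative_eq_intros)
qed

lemma strict_mono_on_threshold: "strict_mono_on {0<..pi / 2} threshold"
proof -
  have "strict_mono_on {0<..pi / 2}
      (\<lambda>x :: real. ((sin x - x * cos x) - (sin 0 - 0 * cos 0))
        / ((x - sin x * cos x) - (0 - sin 0 * cos 0)))"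
    using threshold_derivatives
    by (intro strict_mono_on_difference_quotient[where r = "\<lambda>t. t / (2 * sin t)"
          and v' = "\<lambda>t. 2 * (sin t)\<^sup>2"]
        continuous_intros monotone_on_subset[OF strict_mono_on_half_quotient_id_sin]) auto
  then show ?thesis by (simp add: threshold_def[abs_def])
qed

text \<open>
  Two applications of the mean value theorem give \<open>threshold x = 1 / (2 * cos s)\<close> for some
  \<open>s\<close> strictly between \<open>0\<close> and \<open>x\<close>, and \<open>cos\<close> decreases from \<open>1\<close>.  The upper bound serves to find arguments where \<open>threshold\<close> is close to
  \<open>1 / 2\<close> without computing its limit at \<open>0\<close>.
\<close>

lemma threshold_bounds:
  fixes x :: real
  assumes "0 < x" "x \<le> pi / 2"
  shows "1 / 2 < threshold x" and "x < pi / 2 \<Longrightarrow> threshold x < 1 / (2 * cos x)"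
proof -
  have "\<exists>t. 0 < t \<and> t < x \<and> (sin x - x * cos x) - (sin 0 - 0 * cos 0)
      = t / (2 * sin t) * ((x - sin x * cos x) - (0 - sin 0 * cos 0))"
    using assms threshold_derivatives
    by (intro increment_eq_ratio_times_increment(2)[where v' = "\<lambda>t. 2 * (sin t)\<^sup>2"]
        continuous_intros) auto
  then obtain t where t: "0 < t" "t < x" "threshold x = t / (2 * sin t)"
    using threshold_denominator_pos[OF assms] by (auto simp: threshold_def field_simps)
  obtain s where s: "0 < s" "s < t" "t / (2 * sin t) = 1 / (2 * cos s)"
    using half_quotient_id_sin_eq[of t] t assms by auto
  have pos: "0 < cos s" using s t assms by (intro cos_gt_zero_pi) auto
  have "cos s < cos 0" using s t assms by (intro cos_monotone_0_pi) auto
  then show "1 / 2 < threshold x" using pos unfolding t(3) s(3) by (simp add: field_simps)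
  assume "x < pi / 2"
  then have "0 < cos x" "cos x < cos s"
    using s t assms by (auto intro!: cos_gt_zero_pi cos_monotone_0_pi)
  then show "threshold x < 1 / (2 * cos x)" unfolding t(3) s(3) by (simp add: field_simps)
qed

lemma threshold_pi_half: "threshold (pi / 2) = 2 / pi"
  by (simp add: threshold_def)

lemma continuous_on_threshold: "continuous_on {0<..pi / 2} threshold"
  unfolding threshold_def[abs_def]
  by (intro continuous_intros) (use threshold_denominator_pos in force)

lemma threshold_attains:
  assumes "1 / 2 < p" "p < 2 / pi"
  shows "\<exists>c. 0 < c \<and> c < pi / 2 \<and> threshold c = p"
proof -
  \<comment> \<open>At this point \<open>1 / (2 * cos a) = p\<close>, so the upper bound places \<open>threshold a\<close> below \<open>p\<close>.\<close>
  define a where "a = arccos (1 / (2 * p))"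
  have p: "0 < 1 / (2 * p)" "1 / (2 * p) < 1" using assms by auto
  have "arccos 1 < a" using p unfolding a_def by (intro arccos_less_arccos) linarith+
  moreover have "a < arccos 0" using p unfolding a_def by (intro arccos_less_arccos) linarith+
  ultimately have a: "0 < a" "a < pi / 2" by simp_all
  have "cos a = 1 / (2 * p)" using p unfolding a_def by (intro cos_arccos) linarith+
  then have "threshold a < p" using threshold_bounds(2)[of a] a by simp
  moreover have "continuous_on {a..pi / 2} threshold"
    using a by (intro continuous_on_subset[OF continuous_on_threshold]) auto
  ultimately obtain c where "a \<le> c" "c \<le> pi / 2" "threshold c = p"
    using IVT'[of threshold a p "pi / 2"] a assms by (auto simp: threshold_pi_half)
  moreover from this have "c \<noteq> pi / 2" using assms(2) threshold_pi_half by (metis less_irrefl)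
  ultimately show ?thesis using a by (intro exI[of _ c]) auto
qed

section \<open>Monotonicity of the quotient on subintervals\<close>

lemma f_denominator_pos:
  assumes "0 < p" "0 < x" "x \<le> pi / 2"
  shows "0 < x * (1 + p * cos x)"
proof -
  have "0 \<le> p * cos x" using assms by (auto intro!: mult_nonneg_nonneg cos_ge_zero)
  then show ?thesis using assms by simp
qed

lemma f_has_derivative_threshold:
  assumes "0 < p" "0 < x" "x \<le> pi / 2"
  shows "(f p has_real_derivative
    (x - sin x * cos x) * (p - threshold x) / (x * (1 + p * cos x))\<^sup>2) (at x)"
proof -
  have nz: "x * (1 + p * cos x) \<noteq> 0"
    using f_denominator_pos[OF assms] by (rule less_imp_neq[symmetric])
  have "(x - sin x * cos x) * (p - threshold x)
      = p * (x - sin x * cos x) - (sin x - x * cos x)"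
    using threshold_denominator_pos[OF assms(2,3)] by (simp add: threshold_def field_simps)
  also have "\<dots> = cos x * (x * (1 + p * cos x)) - sin x * (1 + p * cos x - x * (p * sin x))"
  proof -
    have "sin x * sin x = 1 - cos x * cos x"
      using sin_cos_squared_add[of x] by (simp add: power2_eq_square)
    then have "p * x * (sin x * sin x) = p * x * (1 - cos x * cos x)" by simp
    then show ?thesis by (simp add: algebra_simps)
  qed
  \<comment> \<open>Brings the numerator into the form that the quotient rule produces.\<close>
  finally have num: "(x - sin x * cos x) * (p - threshold x)
      = cos x * (x * (1 + p * cos x)) - sin x * (1 + p * cos x - x * (p * sin x))" .
  show ?thesis
    unfolding num f_def[abs_def]
    by (rule derivative_eq_intros refl nz)+ (simp add: power2_eq_square algebra_simps)
qed

lemma continuous_on_f: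
  assumes "0 < p"
  shows "continuous_on {0<..pi / 2} (f p)"
  using f_has_derivative_threshold[OF assms]
  by (intro continuous_at_imp_continuous_on ballI)
    (blast intro: DERIV_isCont dest: greaterThanAtMost_iff[THEN iffD1])

lemma f_less_if_threshold_less:
  assumes "0 < p" "0 < x" "x < y" "y \<le> pi / 2"
    and "\<And>t. x < t \<Longrightarrow> t < y \<Longrightarrow> threshold t < p"
  shows "f p x < f p y"
proof (rule DERIV_pos_imp_increasing_open[OF \<open>x < y\<close>])
  fix t assume t: "x < t" "t < y"
  then have "0 < t" "t \<le> pi / 2" using assms by auto
  moreover from this have "0 < (t - sin t * cos t) * (p - threshold t) / (t * (1 + p * cos t))\<^sup>2"
    using threshold_denominator_pos[of t] f_denominator_pos[of p t] assms(1) assms(5)[OF t]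
    by (intro divide_pos_pos mult_pos_pos) auto
  ultimately show "\<exists>d. (f p has_real_derivative d) (at t) \<and> 0 < d"
    using f_has_derivative_threshold[OF assms(1)] by blast
next
  show "continuous_on {x..y} (f p)"
    using assms by (intro continuous_on_subset[OF continuous_on_f]) auto
qed

lemma f_greater_if_threshold_greater:
  assumes "0 < p" "0 < x" "x < y" "y \<le> pi / 2"
    and "\<And>t. x < t \<Longrightarrow> t < y \<Longrightarrow> p < threshold t"
  shows "f p y < f p x"
proof (rule DERIV_neg_imp_decreasing_open[OF \<open>x < y\<close>])
  fix t assume t: "x < t" "t < y"
  then have "0 < t" "t \<le> pi / 2" using assms by auto
  moreover from this have "(t - sin t * cos t) * (p - threshold t) / (t * (1 + p * cos t))\<^sup>2 < 0"
    using threshold_denominator_pos[of t] f_denominator_pos[of p t] assms(1) assms(5)[OF t]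
    by (intro divide_neg_pos mult_pos_neg) auto
  ultimately show "\<exists>d. (f p has_real_derivative d) (at t) \<and> d < 0"
    using f_has_derivative_threshold[OF assms(1)] by blast
next
  show "continuous_on {x..y} (f p)"
    using assms by (intro continuous_on_subset[OF continuous_on_f]) auto
qed

theorem theorem1:
  fixes p :: real
  assumes "p > 0"
  shows "(p \<ge> 2 / pi \<longrightarrow> strict_mono_on {0<..pi / 2} (f p))
    \<and> (p \<le> 1 / 2 \<longrightarrow> strict_antimono_on {0<..pi / 2} (f p))
    \<and> (1 / 2 < p \<and> p < 2 / pi \<longrightarrow>
        (\<exists>!x. is_arg_max (f p) (\<lambda>x. x \<in> {0<..pi / 2}) x))"
proof (intro conjI impI)
  assume p: "p \<ge> 2 / pi"
  have "threshold t < p" if "0 < t" "t < pi / 2" for t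
    using strict_mono_onD[OF strict_mono_on_threshold, of t "pi / 2"] that p
    by (simp add: threshold_pi_half)
  then show "strict_mono_on {0<..pi / 2} (f p)"
    using assms by (intro strict_mono_onI f_less_if_threshold_less) auto
next
  assume p: "p \<le> 1 / 2"
  have "p < threshold t" if "0 < t" "t < pi / 2" for t
    using threshold_bounds(1)[of t] that p by simp
  then show "strict_antimono_on {0<..pi / 2} (f p)"
    using assms by (intro monotone_onI f_greater_if_threshold_greater) auto
next
  assume "1 / 2 < p \<and> p < 2 / pi"
  then obtain c where c: "0 < c" "c < pi / 2" "threshold c = p"
    using threshold_attains by blast
  have below: "threshold t < p" if "0 < t" "t < c" for t
    using strict_mono_onD[OF strict_mono_on_threshold, of t c] that c by simp
  have above: "p < threshold t" if "c < t" "t < pi / 2" for t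
    using strict_mono_onD[OF strict_mono_on_threshold, of c t] that c by simp
  have max: "f p x < f p c" if "x \<in> {0<..pi / 2}" "x \<noteq> c" for x
  proof (cases "x < c")
    case True
    then show ?thesis using assms that c below by (intro f_less_if_threshold_less) auto
  next
    case False
    then show ?thesis using assms that c above by (intro f_greater_if_threshold_greater) auto
  qed
  show "\<exists>!x. is_arg_max (f p) (\<lambda>x. x \<in> {0<..pi / 2}) x"
  proof (rule ex1I[of _ c])
    show "is_arg_max (f p) (\<lambda>x. x \<in> {0<..pi / 2}) c"
      using c max by (force simp: is_arg_max_def)
    show "x = c" if "is_arg_max (f p) (\<lambda>x. x \<in> {0<..pi / 2}) x" for x
      using that c max[of x] by (auto simp: is_arg_max_def)
  qed
qed

end
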